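(* Let $\mathcal{U}$ and $\mathcal{Y}$ be complete metric spaces. Let $\mathcal{R}$ be a behavior with input-value space $\mathcal{U}$ and output-value space $\mathcal{Y}$, and let $\mathcal{S}$ be a behavior with input-value space $\mathcal{Y}$ and output-value space $\mathcal{U}$. Suppose that $\mathcal{R}$ and $\mathcal{S}$ have Cauchy gains $\gamma_1\in\mathcal{K}_\infty$ and $\gamma_2\in\mathcal{K}_\infty$ respectively, and that $$\gamma_1(\gamma_2(r)) < r \quad \text{for all } r>0 .$$ Then, for all $(\omega,\eta)\in \mathcal{R}\cap\mathcal{S}^{-1}$ for which $\|\omega\|_{\mathrm{aa}}<\infty$, one has $\|\omega\|_{\mathrm{aa}}=\|\eta\|_{\mathrm{aa}}=0$.
   Context: Notation: $\mathbb{R}_{\geq 0}=[0,+\infty)$; in any metric space $M$ the distance between $a$ and $b$ is written $|a-b|$; $[\mathbb{R}_{\geq 0}\to M]$ is the set of all functions $\mathbb{R}_{\geq 0}\to M$. The asymptotic amplitude of $\omega:\mathbb{R}_{\geq 0}\to M$ is $$\|\omega\|_{\mathrm{aa}} := \limsup_{s,t\to\infty}|\omega(t)-\omega(s)| = \lim_{T\to\infty}\Big(\sup_{t,s\geq T}|\omega(t)-\omega(s)|\Big)\in[0,\infty].$$ $\mathcal{K}_\infty$ is the class of continuous, strictly increasing, unbounded functions $\gamma:\mathbb{R}_{\geq 0}\to\mathbb{R}_{\geq 0}$ with $\gamma(0)=0$; one sets $\gamma(+\infty)=+\infty$. A behavior with input-value space $\mathcal{U}$ and output-value space $\mathcal{Y}$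 (complete metric spaces) is a relation $\mathcal{R}\subseteq[\mathbb{R}_{\geq 0}\to\mathcal{U}]\times[\mathbb{R}_{\geq 0}\to\mathcal{Y}]$; its elements $(\omega,\eta)$ are called input/output pairs. The behavior $\mathcal{R}$ has Cauchy gain $\gamma\in\mathcal{K}_\infty$ if $\|\eta\|_{\mathrm{aa}}\leq\gamma(\|\omega\|_{\mathrm{aa}})$ for all $(\omega,\eta)\in\mathcal{R}$. For a behavior $\mathcal{S}$ with input-value space $\mathcal{Y}$ and output-value space $\mathcal{U}$, the inverse behavior $\mathcal{S}^{-1}$ (input-value space $\mathcal{U}$, output-value space $\mathcal{Y}$) consists of all pairs $(\omega,\eta)$ such that $(\eta,\omega)\in\mathcal{S}$. *)

theory Defs
  imports "HOL-Analysis.Analysis"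
begin

text \<open>A function on the nonnegative reals is represented by the unique total function on
  \<^typ>\<open>real\<close> that extends it by \<^term>\<open>undefined\<close> to the negative numbers.\<close>

definition signals :: "(real \<Rightarrow> 'm) set" where
  "signals = {0..} \<rightarrow>\<^sub>E UNIV"

definition behavior ::
    "((real \<Rightarrow> 'u::complete_space) \<times> (real \<Rightarrow> 'y::complete_space)) set \<Rightarrow> bool" where
  "behavior R \<longleftrightarrow> R \<subseteq> signals \<times> signals"

definition asymp_amplitude :: "(real \<Rightarrow> 'm::metric_space) \<Rightarrow> ennreal" where
  "asymp_amplitude \<omega> =
     Limsup (at_top \<times>\<^sub>F at_top) (\<lambda>(s, t). ennreal (dist (\<omega> t) (\<omega> s)))"

definition K_inf :: "(real \<Rightarrow> real) set" where
  "K_inf = {\<gamma>. \<gamma> ` {0..} \<subseteq> {0..} \<and> continuous_on {0..} \<gamma> \<and> strict_mono_on {0..} \<gamma>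
     \<and> \<not> bdd_above (\<gamma> ` {0..}) \<and> \<gamma> 0 = 0}"

definition gain_ext :: "(real \<Rightarrow> real) \<Rightarrow> ennreal \<Rightarrow> ennreal" where
  "gain_ext \<gamma> x = (if x = \<infinity> then \<infinity> else ennreal (\<gamma> (enn2real x)))"

definition has_Cauchy_gain ::
    "((real \<Rightarrow> 'u::complete_space) \<times> (real \<Rightarrow> 'y::complete_space)) set \<Rightarrow> (real \<Rightarrow> real) \<Rightarrow> bool" where
  "has_Cauchy_gain R \<gamma> \<longleftrightarrow> \<gamma> \<in> K_inf \<and>
     (\<forall>(\<omega>, \<eta>) \<in> R. asymp_amplitude \<eta> \<le> gain_ext \<gamma> (asymp_amplitude \<omega>))"

text \<open>The double upper limit is the limit of the diameters of the tails.\<close>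

lemma asymp_amplitude_eq_INF:
  "asymp_amplitude \<omega> = (INF T. SUP (s, t)\<in>{T..} \<times> {T..}. ennreal (dist (\<omega> t) (\<omega> s)))"
    (is "_ = (INF T. ?D T)")
proof (rule antisym)
  show "asymp_amplitude \<omega> \<le> (INF T. ?D T)"
  proof (rule INF_greatest)
    fix T :: real
    have "eventually (\<lambda>p. p \<in> {T..} \<times> {T..}) (at_top \<times>\<^sub>F at_top)"
      by (auto simp: eventually_prod_filter mem_Times_iff
          intro!: exI[of _ "\<lambda>x. x \<ge> T"] eventually_ge_at_top)
    hence "eventually (\<lambda>p. (case p of (s, t) \<Rightarrow> ennreal (dist (\<omega> t) (\<omega> s))) \<le> ?D T)
        (at_top \<times>\<^sub>F at_top)"
      by eventually_elim (rule SUP_upper)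
    thus "asymp_amplitude \<omega> \<le> ?D T"
      unfolding asymp_amplitude_def by (rule Limsup_bounded)
  qed
  show "(INF T. ?D T) \<le> asymp_amplitude \<omega>"
    unfolding asymp_amplitude_def Limsup_def
  proof (rule INF_greatest, clarify)
    fix P :: "real \<times> real \<Rightarrow> bool"
    assume "eventually P (at_top \<times>\<^sub>F at_top)"
    then obtain Q1 Q2 where "eventually Q1 at_top" "eventually Q2 at_top"
        and Q: "\<And>x y. Q1 x \<Longrightarrow> Q2 y \<Longrightarrow> P (x, y)"
      by (auto simp: eventually_prod_filter)
    then obtain T1 T2 where "\<And>x. x \<ge> T1 \<Longrightarrow> Q1 x" "\<And>x. x \<ge> T2 \<Longrightarrow> Q2 x"
      by (auto simp: eventually_at_top_linorder)
    with Q have "{max T1 T2..} \<times> {max T1 T2..} \<subseteq> Collect P" by auto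
    hence "?D (max T1 T2) \<le> (SUP (s, t)\<in>Collect P. ennreal (dist (\<omega> t) (\<omega> s)))"
      by (rule SUP_subset_mono) simp
    thus "(INF T. ?D T) \<le> (SUP (s, t)\<in>Collect P. ennreal (dist (\<omega> t) (\<omega> s)))"
      by (rule INF_lower2[rotated]) simp
  qed
qed

lemma tendsto_asymp_amplitude:
  "((\<lambda>T. SUP (s, t)\<in>{T..} \<times> {T..}. ennreal (dist (\<omega> t) (\<omega> s)))
      \<longlongrightarrow> asymp_amplitude \<omega>) at_top"
    (is "(?D \<longlongrightarrow> _) _")
  unfolding asymp_amplitude_eq_INF
proof (rule order_tendstoI)
  have mono: "?D T \<le> ?D T'" if "T' \<le> T" for T T' :: real
    using that by (intro SUP_subset_mono) auto
  fix a
  show "eventually (\<lambda>T. a < ?D T) at_top" if "a < (INF T. ?D T)"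
    using that by (auto intro!: always_eventually elim!: less_le_trans intro: INF_lower)
  show "eventually (\<lambda>T. ?D T < a) at_top" if less: "(INF T. ?D T) < a"
  proof -
    from less obtain T0 where "?D T0 < a" by (auto simp: INF_less_iff)
    thus ?thesis
      using mono by (intro eventually_at_top_linorderI[of T0]) (rule le_less_trans)
  qed
qed

end

theory Submission
  imports Defs
begin

text \<open>Along an input/output pair of the feedback loop the two gains compose: writing
  \<open>x\<close> and \<open>y\<close> for the amplitudes of \<open>\<omega>\<close> and \<open>\<eta>\<close>, one has \<open>y \<le> \<gamma>\<^sub>1(x)\<close> and \<open>x \<le> \<gamma>\<^sub>2(y)\<close>, so
  \<open>y \<le> \<gamma>\<^sub>1(\<gamma>\<^sub>2(y))\<close> by monotonicity. The small-gain condition forbids this for \<open>y > 0\<close>, hence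
  \<open>y = 0\<close>, and then \<open>x \<le> \<gamma>\<^sub>2(0) = 0\<close>. The argument only makes sense for real amplitudes:
  infinite ones satisfy both gain inequalities. Finiteness of \<open>x\<close> is the hypothesis, and it
  passes to \<open>y\<close> because a gain is finite at finite arguments.\<close>

lemma K_inf_nonneg: "\<gamma> \<in> K_inf \<Longrightarrow> 0 \<le> r \<Longrightarrow> 0 \<le> \<gamma> r"
  unfolding K_inf_def by auto

lemma K_inf_zero: "\<gamma> \<in> K_inf \<Longrightarrow> \<gamma> 0 = 0"
  unfolding K_inf_def by simp

lemma K_inf_mono: "\<gamma> \<in> K_inf \<Longrightarrow> 0 \<le> r \<Longrightarrow> r \<le> s \<Longrightarrow> \<gamma> r \<le> \<gamma> s"
  unfolding K_inf_def using strict_mono_on_leD[of "{0..}" \<gamma> r s] by auto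

text \<open>A gain takes a finite value at a finite input amplitude, so the output amplitude is finite
  too and the gain bound can be read as an inequality of real numbers.\<close>

lemma has_Cauchy_gain_finite:
  assumes gain: "has_Cauchy_gain R \<gamma>" and "(\<omega>, \<eta>) \<in> R"
    and x: "asymp_amplitude \<omega> = ennreal x" "0 \<le> x"
  obtains y where "asymp_amplitude \<eta> = ennreal y" "0 \<le> y" "y \<le> \<gamma> x"
proof -
  have "\<gamma> \<in> K_inf" and le: "asymp_amplitude \<eta> \<le> ennreal (\<gamma> x)"
    using assms by (auto simp: has_Cauchy_gain_def gain_ext_def)
  then have "0 \<le> \<gamma> x"
    using K_inf_nonneg x(2) by blast
  with le that show thesis
    by (cases "asymp_amplitude \<eta>") (auto simp: top_unique)
qed

lemma small_gain_zero:
  assumes K: "\<gamma>\<^sub>1 \<in> K_inf" "\<gamma>\<^sub>2 \<in> K_inf"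
    and small: "\<forall>r>0. \<gamma>\<^sub>1 (\<gamma>\<^sub>2 r) < r"
    and nonneg: "0 \<le> x" "0 \<le> y"
    and loop: "y \<le> \<gamma>\<^sub>1 x" "x \<le> \<gamma>\<^sub>2 y"
  shows "x = 0 \<and> y = 0"
proof -
  have "y \<le> \<gamma>\<^sub>1 (\<gamma>\<^sub>2 y)"
    using loop(1) K_inf_mono[OF K(1) nonneg(1) loop(2)] by linarith
  with small nonneg(2) have "y = 0"
    by (meson less_le_not_le order.order_iff_strict)
  with loop(2) nonneg(1) K_inf_zero[OF K(2)] show ?thesis
    by simp
qed

theorem lemma1p2:
  fixes R :: "((real \<Rightarrow> 'u::complete_space) \<times> (real \<Rightarrow> 'y::complete_space)) set"
    and S :: "((real \<Rightarrow> 'y) \<times> (real \<Rightarrow> 'u)) set"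
    and \<gamma>\<^sub>1 \<gamma>\<^sub>2 :: "real \<Rightarrow> real"
  assumes "behavior R" and "behavior S"
    and "\<gamma>\<^sub>1 \<in> K_inf" and "\<gamma>\<^sub>2 \<in> K_inf"
    and "has_Cauchy_gain R \<gamma>\<^sub>1" and "has_Cauchy_gain S \<gamma>\<^sub>2"
    and "\<forall>r>0. \<gamma>\<^sub>1 (\<gamma>\<^sub>2 r) < r"
  shows "\<forall>(\<omega>, \<eta>) \<in> R \<inter> S\<inverse>. asymp_amplitude \<omega> < \<infinity> \<longrightarrow>
           asymp_amplitude \<omega> = 0 \<and> asymp_amplitude \<eta> = 0"
proof clarify
  fix \<omega> \<eta>
  assume R: "(\<omega>, \<eta>) \<in> R" and S: "(\<eta>, \<omega>) \<in> S" and fin: "asymp_amplitude \<omega> < \<infinity>"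
  from fin obtain x where x: "asymp_amplitude \<omega> = ennreal x" "0 \<le> x"
    by (cases "asymp_amplitude \<omega>") auto
  obtain y where y: "asymp_amplitude \<eta> = ennreal y" "0 \<le> y" "y \<le> \<gamma>\<^sub>1 x"
    using has_Cauchy_gain_finite[OF assms(5) R x] .
  obtain x' where x': "asymp_amplitude \<omega> = ennreal x'" "0 \<le> x'" "x' \<le> \<gamma>\<^sub>2 y"
    using has_Cauchy_gain_finite[OF assms(6) S y(1,2)] .
  with x have "x \<le> \<gamma>\<^sub>2 y"
    by simp
  with small_gain_zero[OF assms(3,4,7) x(2) y(2,3)] x(1) y(1)
  show "asymp_amplitude \<omega> = 0 \<and> asymp_amplitude \<eta> = 0"
    by simp
qed

end
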